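(* Let $\Gamma$ be a graph with at least one edge, and for each positive integer $t$ let $\Gamma_t$ be the graph consisting of $t$ vertex-disjoint copies of $\Gamma$. Let $p = \lim_{n \to \infty} \mu(\text{contains } \Gamma, n)$. Then for every $\varepsilon > 0$ there exists an integer $T$ such that for every fixed integer $t > T$, \[ \lim_{n \to \infty} \mu(\text{contains } \Gamma_t, n) > \left( (1-\varepsilon) \frac{p}{1-p} \right)^{t}. \]
   Context: For graphs $G, H$ on the common vertex set $\{1,\ldots,n\}$, $G \cap H$ denotes the graph on $\{1,\ldots,n\}$ with edge set $E(G) \cap E(H)$. For a graph property $\mathcal{P}$, a family $\mathcal{F}$ of graphs on $\{1,\ldots,n\}$ is $\mathcal{P}$-intersecting if $G \cap H$ satisfies $\mathcal{P}$ for all $G, H \in \mathcal{F}$. Define $\mu(\mathcal{P}, n) := \max\{ |\mathcal{F}| \cdot 2^{-\binom{n}{2}} : \mathcal{F} \text{ is } \mathcal{P}\text{-intersecting on } \{1,\ldots,n\}\}$. The property "contains $\Gamma$" means having a (not necessarily induced) subgraph isomorphic to $\Gamma$. For such properties $\mu(\text{contains }\Gamma, n)$ is non-decreasing in $n$, so the limits as $n\to\infty$ exist; moreover $\mu(\text{contains }\Gamma,n) \le 1/2$ for nonempty $\Gamma$, so $p \in (0,1/2]$.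
   Formalization: The formal theorem takes 0 < ε < 2 instead of every ε > 0: for ε ≥ 2 the literal claim fails, e.g. for Γ = K_2 one has p = 1/2 and the bound (1-ε)^t is at least 1 for even t, while μ ≤ 1/2. *)

theory Defs
  imports Complex_Main
begin

type_synonym 'a graph = "'a set \<times> 'a set set"

abbreviation verts :: "'a graph \<Rightarrow> 'a set" where
  "verts G \<equiv> fst G"

abbreviation edges :: "'a graph \<Rightarrow> 'a set set" where
  "edges G \<equiv> snd G"

definition simple_graph :: "'a graph \<Rightarrow> bool" where
  "simple_graph G \<longleftrightarrow> finite (verts G) \<and> (\<forall>e \<in> edges G. e \<subseteq> verts G \<and> card e = 2)"

definition graphs_on :: "nat \<Rightarrow> nat graph set" where
  "graphs_on n = {G. simple_graph G \<and> verts G = {1..n}}"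

definition graph_inter :: "'a graph \<Rightarrow> 'a graph \<Rightarrow> 'a graph" where
  "graph_inter G H = (verts G \<inter> verts H, edges G \<inter> edges H)"

definition subgraph :: "'a graph \<Rightarrow> 'a graph \<Rightarrow> bool" where
  "subgraph H G \<longleftrightarrow> simple_graph H \<and> verts H \<subseteq> verts G \<and> edges H \<subseteq> edges G"

definition isomorphic :: "'a graph \<Rightarrow> 'b graph \<Rightarrow> bool" where
  "isomorphic G H \<longleftrightarrow>
     (\<exists>f. bij_betw f (verts G) (verts H) \<and> edges H = (\<lambda>e. f ` e) ` edges G)"

definition contains :: "'a graph \<Rightarrow> 'b graph \<Rightarrow> bool" where
  "contains \<Gamma> G \<longleftrightarrow> (\<exists>H. subgraph H G \<and> isomorphic \<Gamma> H)"

definition intersecting :: "(nat graph \<Rightarrow> bool) \<Rightarrow> nat \<Rightarrow> nat graph set \<Rightarrow> bool" where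
  "intersecting P n F \<longleftrightarrow> F \<subseteq> graphs_on n \<and> (\<forall>G \<in> F. \<forall>H \<in> F. P (graph_inter G H))"

definition mu :: "(nat graph \<Rightarrow> bool) \<Rightarrow> nat \<Rightarrow> real" where
  "mu P n = Max {real (card F) / 2 ^ (n choose 2) | F. intersecting P n F}"

definition copies :: "nat \<Rightarrow> 'a graph \<Rightarrow> ('a \<times> nat) graph" where
  "copies t \<Gamma> =
     (verts \<Gamma> \<times> {..<t}, {(\<lambda>v. (v, i)) ` e | e i. e \<in> edges \<Gamma> \<and> i < t})"

text \<open>The maximum in \<^const>\<open>mu\<close> ranges over a finite nonempty set.\<close>

lemma finite_graphs_on: "finite (graphs_on n)"
proof (rule finite_subset)
  show "graphs_on n \<subseteq> {{1..n}} \<times> Pow (Pow {1..n})"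
    unfolding graphs_on_def simple_graph_def by fastforce
qed simp

lemma finite_mu_set: "finite {real (card F) / 2 ^ (n choose 2) | F. intersecting P n F}"
proof -
  have "finite {F. intersecting P n F}"
    by (rule finite_subset[of _ "Pow (graphs_on n)"])
       (auto simp: intersecting_def finite_graphs_on)
  then show ?thesis by simp
qed

lemma mu_set_nonempty: "{real (card F) / 2 ^ (n choose 2) | F. intersecting P n F} \<noteq> {}"
proof -
  have "intersecting P n {}" by (simp add: intersecting_def)
  then show ?thesis by blast
qed

end

theory Submission
  imports Defs "HOL-Library.FuncSet"
begin

text \<open>Take a nearly optimal \<open>\<Gamma>\<close>-intersecting family \<open>F\<close> on \<open>n\<close> vertices, of density \<open>q < 1/2\<close>, and
  place \<open>m\<close> disjoint blocks of \<open>n\<close> vertices in \<open>{1..N}\<close>. The graphs that restrict to a member of \<open>F\<close>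
  on exactly \<open>k\<close> blocks, with \<open>2k - m \<ge> t\<close>, pairwise share \<open>t\<close> such blocks, hence \<open>t\<close> disjoint copies
  of \<open>\<Gamma>\<close>. Their density is the binomial probability of \<open>k\<close> successes in \<open>m\<close> trials. For
  \<open>m \<approx> t / (1 - 2q)\<close> and \<open>k \<approx> (1 - q) m\<close> it equals, up to a factor polynomial in \<open>t\<close>,
  \<open>(q / (1 - q)) ^ t\<close>, and the polynomial factor is absorbed by \<open>(1 - \<epsilon>) ^ t\<close>.\<close>

section \<open>Embeddings and disjoint copies\<close>

text \<open>The image of an embedding is itself the witnessing subgraph; it is simple because
  injectivity keeps two endpoints on every edge. Containment can then be handled through explicit
  maps.\<close>

lemma contains_iff:
  assumes "simple_graph \<Gamma>"
  shows "contains \<Gamma> G \<longleftrightarrow>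
    (\<exists>f. inj_on f (verts \<Gamma>) \<and> f ` verts \<Gamma> \<subseteq> verts G \<and> (\<lambda>e. f ` e) ` edges \<Gamma> \<subseteq> edges G)"
    (is "_ \<longleftrightarrow> (\<exists>f. ?emb f)")
proof
  assume "contains \<Gamma> G"
  then obtain H f where "subgraph H G" "bij_betw f (verts \<Gamma>) (verts H)"
    "edges H = (\<lambda>e. f ` e) ` edges \<Gamma>"
    unfolding contains_def isomorphic_def by blast
  then have "?emb f"
    by (auto simp: subgraph_def bij_betw_def)
  then show "\<exists>f. ?emb f" by blast
next
  assume "\<exists>f. ?emb f"
  then obtain f where f: "?emb f" by blast
  let ?H = "(f ` verts \<Gamma>, (\<lambda>e. f ` e) ` edges \<Gamma>)"
  have "card (f ` e) = 2" if "e \<in> edges \<Gamma>" for e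
    using that assms f by (metis card_image inj_on_subset simple_graph_def)
  then have "simple_graph ?H"
    using assms by (auto simp: simple_graph_def)
  then have "subgraph ?H G"
    using f by (auto simp: subgraph_def)
  moreover have "isomorphic \<Gamma> ?H"
    using f by (auto simp: isomorphic_def bij_betw_def)
  ultimately show "contains \<Gamma> G"
    unfolding contains_def by blast
qed

lemma simple_graph_copies: "simple_graph \<Gamma> \<Longrightarrow> simple_graph (copies t \<Gamma>)"
  by (auto simp: simple_graph_def copies_def card_image inj_on_def)

lemma edges_copies_nonempty: "edges \<Gamma> \<noteq> {} \<Longrightarrow> 0 < t \<Longrightarrow> edges (copies t \<Gamma>) \<noteq> {}"
  by (auto simp: copies_def)

text \<open>Lets monotonicity in the number of vertices be read off from the block construction with
  a single block.\<close>

lemma contains_copies_1: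
  assumes "simple_graph \<Gamma>"
  shows "contains (copies 1 \<Gamma>) G \<longleftrightarrow> contains \<Gamma> G"
proof
  assume "contains (copies 1 \<Gamma>) G"
  then obtain f where f: "inj_on f (verts (copies 1 \<Gamma>))" "f ` verts (copies 1 \<Gamma>) \<subseteq> verts G"
      "(\<lambda>e. f ` e) ` edges (copies 1 \<Gamma>) \<subseteq> edges G"
    using contains_iff[OF simple_graph_copies[OF assms]] by blast
  have "(\<lambda>v. f (v, 0)) ` e \<in> edges G" if "e \<in> edges \<Gamma>" for e
  proof -
    have "(\<lambda>v. (v, 0)) ` e \<in> edges (copies 1 \<Gamma>)"
      using that by (auto simp: copies_def)
    then have "f ` (\<lambda>v. (v, 0)) ` e \<in> edges G"
      using f(3) by blast
    then show ?thesis by (simp add: image_image)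
  qed
  moreover have "inj_on (\<lambda>v. f (v, 0)) (verts \<Gamma>)" "(\<lambda>v. f (v, 0)) ` verts \<Gamma> \<subseteq> verts G"
    using f(1,2) by (auto simp: copies_def inj_on_def)
  ultimately show "contains \<Gamma> G"
    unfolding contains_iff[OF assms] by blast
next
  assume "contains \<Gamma> G"
  then obtain f where f: "inj_on f (verts \<Gamma>)" "f ` verts \<Gamma> \<subseteq> verts G"
      "(\<lambda>e. f ` e) ` edges \<Gamma> \<subseteq> edges G"
    using contains_iff[OF assms] by blast
  then show "contains (copies 1 \<Gamma>) G"
    unfolding contains_iff[OF simple_graph_copies[OF assms]]
    by (intro exI[of _ "f \<circ> fst"]) (auto simp: copies_def inj_on_def image_image)
qed

section \<open>Families of edge sets and the density \<open>mu\<close>\<close>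

definition all_edges :: "nat \<Rightarrow> nat set set" where
  "all_edges n = {e. e \<subseteq> {1..n} \<and> card e = 2}"

lemma finite_all_edges: "finite (all_edges n)"
  by (rule finite_subset[of _ "Pow {1..n}"]) (auto simp: all_edges_def)

lemma card_all_edges: "card (all_edges n) = n choose 2"
  using n_subsets[of "{1..n}" 2] by (simp add: all_edges_def)

text \<open>Since the vertex set is fixed, a graph is its edge set, and families can be treated as
  subsets of \<open>Pow (all_edges n)\<close>.\<close>

lemma graphs_on_eq: "graphs_on n = Pair {1..n} ` Pow (all_edges n)"
proof (intro set_eqI)
  fix G :: "nat graph"
  obtain V S where "G = (V, S)" by (metis surj_pair)
  then show "G \<in> graphs_on n \<longleftrightarrow> G \<in> Pair {1..n} ` Pow (all_edges n)"
    by (auto simp: graphs_on_def simple_graph_def all_edges_def)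
qed

lemma intersecting_Pair_iff:
  "intersecting P n (Pair {1..n} ` F) \<longleftrightarrow>
    F \<subseteq> Pow (all_edges n) \<and> (\<forall>S\<in>F. \<forall>S'\<in>F. P ({1..n}, S \<inter> S'))"
  by (auto simp: intersecting_def graphs_on_eq graph_inter_def)

lemma mu_ge:
  assumes "F \<subseteq> Pow (all_edges n)" "\<And>S S'. S \<in> F \<Longrightarrow> S' \<in> F \<Longrightarrow> P ({1..n}, S \<inter> S')"
  shows "real (card F) / 2 ^ (n choose 2) \<le> mu P n"
proof -
  have "intersecting P n (Pair {1..n} ` F)"
    unfolding intersecting_Pair_iff using assms by blast
  moreover have "card (Pair {1..n} ` F) = card F"
    by (simp add: card_image inj_on_def)
  ultimately have "real (card F) / 2 ^ (n choose 2)
      \<in> {real (card F) / 2 ^ (n choose 2) | F. intersecting P n F}"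
    by (metis (mono_tags, lifting) mem_Collect_eq)
  then show ?thesis
    unfolding mu_def by (rule Max_ge[OF finite_mu_set])
qed

lemma mu_attained:
  obtains F where "F \<subseteq> Pow (all_edges n)" "\<And>S S'. S \<in> F \<Longrightarrow> S' \<in> F \<Longrightarrow> P ({1..n}, S \<inter> S')"
    "mu P n = real (card F) / 2 ^ (n choose 2)"
proof -
  have "mu P n \<in> {real (card F) / 2 ^ (n choose 2) | F. intersecting P n F}"
    unfolding mu_def by (rule Max_in[OF finite_mu_set mu_set_nonempty])
  then obtain F' where F': "intersecting P n F'" "mu P n = real (card F') / 2 ^ (n choose 2)"
    by blast
  then have "F' \<subseteq> Pair {1..n} ` Pow (all_edges n)"
    by (simp add: intersecting_def graphs_on_eq)
  then obtain F where F: "F' = Pair {1..n} ` F"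
    by (auto simp: subset_image_iff)
  moreover have "card (Pair {1..n} ` F) = card F"
    by (simp add: card_image inj_on_def)
  ultimately show thesis
    using that F' by (metis intersecting_Pair_iff)
qed

text \<open>An edge set and its complement cannot both lie in \<open>F\<close>: they share no edge,
  while \<Gamma> has one. So \<open>F\<close> and the family of its complements are disjoint and of
  equal size.\<close>

lemma card_intersecting_le:
  assumes "simple_graph \<Gamma>" "edges \<Gamma> \<noteq> {}" and F: "F \<subseteq> Pow (all_edges n)"
    and int: "\<And>S S'. S \<in> F \<Longrightarrow> S' \<in> F \<Longrightarrow> contains \<Gamma> ({1..n}, S \<inter> S')"
  shows "2 * card F \<le> 2 ^ (n choose 2)"
proof -
  let ?C = "(\<lambda>S. all_edges n - S) ` F"
  have fin: "finite (Pow (all_edges n))"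
    by (simp add: finite_all_edges)
  have "inj_on (\<lambda>S. all_edges n - S) F"
    using F by (auto simp: inj_on_def)
  then have "card ?C = card F"
    by (rule card_image)
  moreover have "F \<inter> ?C = {}"
  proof (rule ccontr)
    assume "F \<inter> ?C \<noteq> {}"
    then obtain S where "S \<in> F" "all_edges n - S \<in> F" by blast
    then have "contains \<Gamma> ({1..n}, S \<inter> (all_edges n - S))" by (rule int)
    then have "contains \<Gamma> ({1..n}, {})"
      by (simp add: Diff_disjoint)
    then show False
      using assms(2) by (auto simp: contains_iff[OF assms(1)])
  qed
  moreover have "finite F" using F fin by (rule finite_subset)
  ultimately have "2 * card F = card (F \<union> ?C)"
    by (simp add: card_Un_disjoint)
  also have "\<dots> \<le> card (Pow (all_edges n))"
    using F by (intro card_mono fin) auto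
  finally show ?thesis
    by (simp add: card_Pow finite_all_edges card_all_edges)
qed

lemma mu_contains_le_half:
  assumes "simple_graph \<Gamma>" "edges \<Gamma> \<noteq> {}"
  shows "mu (contains \<Gamma>) n \<le> 1 / 2"
proof -
  obtain F where F: "F \<subseteq> Pow (all_edges n)"
      "\<And>S S'. S \<in> F \<Longrightarrow> S' \<in> F \<Longrightarrow> contains \<Gamma> ({1..n}, S \<inter> S')"
    and mu: "mu (contains \<Gamma>) n = real (card F) / 2 ^ (n choose 2)"
    using mu_attained[of n "contains \<Gamma>"] by blast
  have "2 * real (card F) \<le> 2 ^ (n choose 2)"
    using card_intersecting_le[OF assms F] by (metis of_nat_le_iff of_nat_mult of_nat_numeral of_nat_power)
  then show ?thesis
    by (simp add: mu field_simps)
qed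

text \<open>The complete graph alone forms an intersecting family once \<Gamma> fits on the vertex
  set. This makes the limit \<open>p\<close> positive.\<close>

lemma mu_contains_pos:
  assumes "simple_graph \<Gamma>"
  shows "0 < mu (contains \<Gamma>) (card (verts \<Gamma>))"
proof -
  let ?n = "card (verts \<Gamma>)"
  have fin: "finite (verts \<Gamma>)"
    using assms by (simp add: simple_graph_def)
  then obtain f where f: "bij_betw f (verts \<Gamma>) {1..?n}"
    using finite_same_card_bij[of "verts \<Gamma>" "{1..?n}"] by auto
  have "f ` e \<in> all_edges ?n" if "e \<in> edges \<Gamma>" for e
  proof -
    have e: "e \<subseteq> verts \<Gamma>" "card e = 2"
      using that assms by (auto simp: simple_graph_def)
    then have "card (f ` e) = 2"
      using f by (metis bij_betw_def card_image inj_on_subset)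
    moreover have "f ` e \<subseteq> {1..?n}"
      using e f by (auto simp: bij_betw_def)
    ultimately show ?thesis by (simp add: all_edges_def)
  qed
  then have "contains \<Gamma> ({1..?n}, all_edges ?n)"
    using f by (auto simp: contains_iff[OF assms] bij_betw_def)
  then have "real (card {all_edges ?n}) / 2 ^ (?n choose 2) \<le> mu (contains \<Gamma>) ?n"
    by (intro mu_ge) auto
  moreover have "0 < real (card {all_edges ?n}) / 2 ^ (?n choose 2)" by simp
  ultimately show ?thesis by linarith
qed

section \<open>Counting choices with exactly \<open>k\<close> successes\<close>

text \<open>An unnormalised binomial distribution: the functions are sorted by the set
  \<open>I\<close> of indices whose value lies in \<open>F\<close>, and each class
  \<open>?P I\<close> is a product.\<close>

lemma card_PiE_exactly:
  assumes "finite U" "F \<subseteq> U"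
  shows "card {f \<in> {..<m} \<rightarrow>\<^sub>E U. card {i \<in> {..<m}. f i \<in> F} = k}
    = (m choose k) * card F ^ k * (card U - card F) ^ (m - k)"
proof -
  let ?K = "{I. I \<subseteq> {..<m} \<and> card I = k}"
  let ?P = "\<lambda>I. PiE {..<m} (\<lambda>i. if i \<in> I then F else U - F)"
  have finF: "finite F" using assms by (rule finite_subset[rotated])
  \<comment> \<open>\<open>I\<close> can be recovered from any \<open>f\<close> in its class, so
    distinct classes are disjoint.\<close>
  have P_eq: "{i \<in> {..<m}. f i \<in> F} = I" if "I \<subseteq> {..<m}" "f \<in> ?P I" for f I
    using that by (force simp: PiE_iff split: if_splits)
  have "{f \<in> {..<m} \<rightarrow>\<^sub>E U. card {i \<in> {..<m}. f i \<in> F} = k} = (\<Union>I\<in>?K. ?P I)" (is "?L = ?R")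
  proof
    show "?L \<subseteq> ?R"
    proof
      fix f assume f: "f \<in> ?L"
      then have "f \<in> ?P {i \<in> {..<m}. f i \<in> F}"
        by (auto simp: PiE_iff)
      moreover have "{i \<in> {..<m}. f i \<in> F} \<in> ?K" using f by auto
      ultimately show "f \<in> ?R" by (rule UN_I[rotated])
    qed
    show "?R \<subseteq> ?L"
    proof
      fix f assume "f \<in> ?R"
      then obtain I where I: "I \<in> ?K" "f \<in> ?P I" by blast
      then have "f \<in> {..<m} \<rightarrow>\<^sub>E U"
        using assms(2) by (fastforce simp: PiE_iff split: if_splits)
      then show "f \<in> ?L" using P_eq[of I f] I by simp
    qed
  qed
  also have "card \<dots> = (\<Sum>I\<in>?K. card (?P I))"
  proof (rule card_UN_disjoint)
    show "\<forall>I\<in>?K. finite (?P I)"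
      using assms finF by (auto intro!: finite_PiE)
    show "\<forall>I\<in>?K. \<forall>J\<in>?K. I \<noteq> J \<longrightarrow> ?P I \<inter> ?P J = {}"
    proof (intro ballI impI equals0I)
      fix I J f assume "I \<in> ?K" "J \<in> ?K" "I \<noteq> J" "f \<in> ?P I \<inter> ?P J"
      then show False using P_eq[of I f] P_eq[of J f] by simp
    qed
  qed simp
  also have "\<dots> = (\<Sum>I\<in>?K. card F ^ k * (card U - card F) ^ (m - k))"
  proof (rule sum.cong[OF refl])
    fix I assume I: "I \<in> ?K"
    have "card (?P I) = (\<Prod>i<m. if i \<in> I then card F else card U - card F)"
      using card_Diff_subset[OF finF assms(2)] by (simp add: card_PiE if_distrib cong: if_cong)
    also have "\<dots> = card F ^ card ({..<m} \<inter> I) * (card U - card F) ^ card ({..<m} - I)"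
      by (simp add: prod.If_cases Diff_eq Int_def)
    also have "{..<m} \<inter> I = I" using I by blast
    also have "card ({..<m} - I) = m - k"
      using I by (subst card_Diff_subset) (auto intro: finite_subset)
    finally show "card (?P I) = card F ^ k * (card U - card F) ^ (m - k)"
      using I by simp
  qed
  also have "\<dots> = (m choose k) * card F ^ k * (card U - card F) ^ (m - k)"
    by (simp add: n_subsets)
  finally show ?thesis .
qed

section \<open>Disjoint blocks of vertices\<close>

lemma shift_eq_iff:
  fixes x y i j n :: nat
  assumes "x \<in> {1..n}" "y \<in> {1..n}"
  shows "x + i * n = y + j * n \<longleftrightarrow> x = y \<and> i = j"
proof
  assume eq: "x + i * n = y + j * n"
  \<comment> \<open>Vertices are numbered from 1, so block \<open>l\<close> is
    \<open>{l*n+1..l*n+n}\<close>; subtracting 1 before dividing recovers its index.\<close>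
  have dv: "(z + l * n - 1) div n = l" if "z \<in> {1..n}" for z l
  proof -
    have "z + l * n - 1 = (z - 1) + l * n" "z - 1 < n" using that by auto
    then show ?thesis by simp
  qed
  have "i = j" using dv[OF assms(1), of i] dv[OF assms(2), of j] eq by simp
  then show "x = y \<and> i = j" using eq by simp
qed simp

lemma shift_in_range:
  fixes x i m n N :: nat
  assumes "x \<in> {1..n}" "i < m" "m * n \<le> N"
  shows "x + i * n \<in> {1..N}"
proof -
  have "Suc i * n \<le> m * n" using assms(2) by (intro mult_le_mono1) simp
  then show ?thesis using assms by auto
qed

definition shift_edge :: "nat \<Rightarrow> nat \<Rightarrow> nat set \<Rightarrow> nat set" where
  "shift_edge n i e = (\<lambda>x. x + i * n) ` e"

lemma shift_edge_in:
  assumes "e \<in> all_edges n" "i < m" "m * n \<le> N"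
  shows "shift_edge n i e \<in> all_edges N"
proof -
  have "shift_edge n i e \<subseteq> {1..N}"
    using assms shift_in_range[OF _ assms(2,3)] unfolding shift_edge_def all_edges_def by blast
  moreover have "card (shift_edge n i e) = 2"
    using assms(1) by (simp add: shift_edge_def all_edges_def card_image)
  ultimately show ?thesis by (simp add: all_edges_def)
qed

lemma shift_edge_eq_iff:
  assumes "e \<in> all_edges n" "e' \<in> all_edges n"
  shows "shift_edge n i e = shift_edge n j e' \<longleftrightarrow> e = e' \<and> i = j"
proof
  assume eq: "shift_edge n i e = shift_edge n j e'"
  have sub: "e \<subseteq> {1..n}" "e' \<subseteq> {1..n}" and "e \<noteq> {}"
    using assms by (auto simp: all_edges_def)
  then obtain x where x: "x \<in> e" by blast
  then have "x + i * n \<in> shift_edge n j e'"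
    unfolding eq[symmetric] by (simp add: shift_edge_def)
  then obtain y where "y \<in> e'" "x + i * n = y + j * n"
    by (auto simp: shift_edge_def)
  then have "i = j" using x sub shift_eq_iff by blast
  then have "e = e'"
    using eq inj_image_eq_iff[of "\<lambda>x. x + i * n" e e'] by (simp add: shift_edge_def inj_def)
  with \<open>i = j\<close> show "e = e' \<and> i = j" by simp
qed simp

text \<open>The subgraph induced on the \<open>i\<close>-th block, transported back to
  \<open>{1..n}\<close> so that it can be compared with members of a family there.\<close>

definition block :: "nat \<Rightarrow> nat \<Rightarrow> nat set set \<Rightarrow> nat set set" where
  "block n i S = {e \<in> all_edges n. shift_edge n i e \<in> S}"

lemma block_Int: "block n i (S \<inter> S') = block n i S \<inter> block n i S'"
  by (auto simp: block_def)

text \<open>Every block indexed by \<open>J\<close> hosts a copy of \<Gamma>, and the blocks are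
  vertex-disjoint, hence so are the copies.\<close>

lemma contains_copies_of_blocks:
  assumes \<Gamma>: "simple_graph \<Gamma>" and N: "m * n \<le> N" and J: "J \<subseteq> {..<m}" "t \<le> card J"
    and blocks: "\<And>j. j \<in> J \<Longrightarrow> contains \<Gamma> ({1..n}, block n j S)"
  shows "contains (copies t \<Gamma>) ({1..N}, S)"
proof -
  have "finite J" using J(1) by (rule finite_subset) simp
  then obtain g where g: "inj_on g {..<t}" "g ` {..<t} \<subseteq> J"
    using card_le_inj[of "{..<t}" J] J(2) by auto
  have "\<forall>j\<in>J. \<exists>f. inj_on f (verts \<Gamma>) \<and> f ` verts \<Gamma> \<subseteq> {1..n} \<and>
      (\<lambda>e. f ` e) ` edges \<Gamma> \<subseteq> block n j S"
    using blocks by (auto simp: contains_iff[OF \<Gamma>])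
  then obtain h where h: "\<And>j. j \<in> J \<Longrightarrow> inj_on (h j) (verts \<Gamma>)"
      "\<And>j. j \<in> J \<Longrightarrow> h j ` verts \<Gamma> \<subseteq> {1..n}"
      "\<And>j. j \<in> J \<Longrightarrow> (\<lambda>e. h j ` e) ` edges \<Gamma> \<subseteq> block n j S"
    by metis
  \<comment> \<open>\<open>g\<close> selects \<open>t\<close> distinct blocks; copy \<open>i\<close>
    is embedded by \<open>h (g i)\<close> and then moved into block \<open>g i\<close>.\<close>
  define f where "f = (\<lambda>(v, i). h (g i) v + g i * n)"
  have gJ: "g i \<in> J" if "i < t" for i using g(2) that by blast
  have gm: "g i < m" if "i < t" for i using gJ[OF that] J(1) by blast
  have hr: "h (g i) v \<in> {1..n}" if "v \<in> verts \<Gamma>" "i < t" for v i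
    using h(2)[OF gJ[OF that(2)]] that(1) by blast
  have "inj_on f (verts (copies t \<Gamma>))"
  proof (rule inj_onI)
    fix a b assume ab: "a \<in> verts (copies t \<Gamma>)" "b \<in> verts (copies t \<Gamma>)" "f a = f b"
    obtain v i w j where [simp]: "a = (v, i)" "b = (w, j)" by (metis surj_pair)
    have vw: "v \<in> verts \<Gamma>" "w \<in> verts \<Gamma>" "i < t" "j < t"
      using ab by (auto simp: copies_def)
    have "h (g i) v + g i * n = h (g j) w + g j * n"
      using ab(3) by (simp add: f_def)
    then have eq: "h (g i) v = h (g j) w" "g i = g j"
      using shift_eq_iff[OF hr[OF vw(1,3)] hr[OF vw(2,4)]] by auto
    then have "i = j" using g(1) vw by (auto simp: inj_on_def)
    moreover have "v = w"
      using h(1)[OF gJ[OF vw(3)]] eq vw by (auto simp: inj_on_def)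
    ultimately show "a = b" by simp
  qed
  moreover have "f ` verts (copies t \<Gamma>) \<subseteq> {1..N}"
    using shift_in_range[OF hr gm N] by (auto simp: f_def copies_def)
  moreover have "(\<lambda>e. f ` e) ` edges (copies t \<Gamma>) \<subseteq> S"
  proof
    fix x assume "x \<in> (\<lambda>e. f ` e) ` edges (copies t \<Gamma>)"
    then obtain e i where e: "e \<in> edges \<Gamma>" "i < t" "x = f ` (\<lambda>v. (v, i)) ` e"
      by (auto simp: copies_def)
    then have "x = shift_edge n (g i) (h (g i) ` e)"
      by (simp add: shift_edge_def f_def image_image)
    moreover have "h (g i) ` e \<in> block n (g i) S"
      using h(3)[OF gJ[OF e(2)]] e(1) by blast
    ultimately show "x \<in> S" by (simp add: block_def)
  qed
  ultimately show ?thesis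
    unfolding contains_iff[OF simple_graph_copies[OF \<Gamma>]] by auto
qed

text \<open>The contents of the blocks and the edges outside all blocks can be chosen independently,
  which gives an injection into the counted family. Multiplying by both powers of two keeps this
  binomial probability estimate in the natural numbers.\<close>

lemma card_exactly_k_blocks:
  assumes F: "F \<subseteq> Pow (all_edges n)" and N: "m * n \<le> N"
  shows "(m choose k) * card F ^ k * (2 ^ (n choose 2) - card F) ^ (m - k) * 2 ^ (N choose 2)
    \<le> card {S \<in> Pow (all_edges N). card {i \<in> {..<m}. block n i S \<in> F} = k}
       * 2 ^ (m * (n choose 2))"
proof -
  let ?H = "{S \<in> Pow (all_edges N). card {i \<in> {..<m}. block n i S \<in> F} = k}"
  let ?X = "{f \<in> {..<m} \<rightarrow>\<^sub>E Pow (all_edges n). card {i \<in> {..<m}. f i \<in> F} = k}"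
  \<comment> \<open>\<open>B\<close> collects the edges inside blocks and \<open>R\<close> the
    remaining ones; \<Phi> glues block contents \<open>f\<close> and a remainder \<open>T\<close>
    into one edge set.\<close>
  define B where "B = (\<lambda>(i, e). shift_edge n i e) ` ({..<m} \<times> all_edges n)"
  define R where "R = all_edges N - B"
  define \<Phi> where "\<Phi> = (\<lambda>(f, T). T \<union> (\<Union>i<m. shift_edge n i ` f i))"
  have B_sub: "B \<subseteq> all_edges N"
    using shift_edge_in[OF _ _ N] by (auto simp: B_def)
  have "inj_on (\<lambda>(i, e). shift_edge n i e) ({..<m} \<times> all_edges n)"
    by (auto simp: inj_on_def shift_edge_eq_iff)
  then have "card B = m * (n choose 2)"
    by (simp add: B_def card_image card_cartesian_product card_all_edges)
  moreover have "finite B" using B_sub finite_all_edges by (rule finite_subset)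
  ultimately have card_N: "N choose 2 = card R + m * (n choose 2)"
    using card_Diff_subset[of B "all_edges N"] card_mono[OF finite_all_edges B_sub] B_sub
    by (simp add: R_def card_all_edges)
  have finR: "finite R" by (simp add: R_def finite_all_edges)
  \<comment> \<open>\<open>T\<close> avoids \<open>B\<close>, and a shifted edge determines its
    block, so \<open>f\<close> can be read back blockwise. Together with \<open>rest\<close> this
    inverts \<Phi>.\<close>
  have blk: "block n i (\<Phi> (f, T)) = f i" if "f \<in> ?X" "T \<in> Pow R" "i < m" for f T i
  proof -
    have sub: "f j \<subseteq> all_edges n" if "j < m" for j
      using \<open>f \<in> ?X\<close> that by (auto simp: PiE_iff)
    show ?thesis
    proof
      show "block n i (\<Phi> (f, T)) \<subseteq> f i"
      proof
        fix e assume "e \<in> block n i (\<Phi> (f, T))"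
        then have e: "e \<in> all_edges n" "shift_edge n i e \<in> \<Phi> (f, T)"
          by (auto simp: block_def)
        have "shift_edge n i e \<in> B"
          using e(1) \<open>i < m\<close> by (force simp: B_def)
        then have "shift_edge n i e \<notin> T" using \<open>T \<in> Pow R\<close> by (auto simp: R_def)
        then obtain j e' where "j < m" "e' \<in> f j" "shift_edge n i e = shift_edge n j e'"
          using e(2) by (auto simp: \<Phi>_def)
        then show "e \<in> f i"
          using sub[of j] shift_edge_eq_iff[OF e(1), of e' i j] by auto
      qed
      show "f i \<subseteq> block n i (\<Phi> (f, T))"
        using sub[OF \<open>i < m\<close>] \<open>i < m\<close> by (auto simp: block_def \<Phi>_def)
    qed
  qed
  have rest: "\<Phi> (f, T) \<inter> R = T" if "f \<in> ?X" "T \<in> Pow R" for f T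
  proof -
    have "f j \<subseteq> all_edges n" if "j < m" for j
      using \<open>f \<in> ?X\<close> that by (auto simp: PiE_iff)
    then have "(\<Union>i<m. shift_edge n i ` f i) \<subseteq> B"
      by (force simp: B_def)
    then show ?thesis using that(2) by (auto simp: \<Phi>_def R_def)
  qed
  have "inj_on \<Phi> (?X \<times> Pow R)"
  proof (rule inj_onI)
    fix a b assume ab: "a \<in> ?X \<times> Pow R" "b \<in> ?X \<times> Pow R" "\<Phi> a = \<Phi> b"
    obtain f T g U where [simp]: "a = (f, T)" "b = (g, U)" by (metis surj_pair)
    have fg: "f \<in> ?X" "T \<in> Pow R" "g \<in> ?X" "U \<in> Pow R" using ab by auto
    have "T = U" using rest[OF fg(1,2)] rest[OF fg(3,4)] ab(3) by simp
    moreover have "f = g"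
    proof (rule PiE_ext[of f "{..<m}" "\<lambda>_. Pow (all_edges n)" g])
      fix i assume "i \<in> {..<m}"
      then show "f i = g i"
        using blk[OF fg(1,2)] blk[OF fg(3,4)] ab(3) by simp
    qed (use fg in auto)
    ultimately show "a = b" by simp
  qed
  moreover have "\<Phi> ` (?X \<times> Pow R) \<subseteq> ?H"
  proof
    fix S assume "S \<in> \<Phi> ` (?X \<times> Pow R)"
    then obtain f T where S: "S = \<Phi> (f, T)" and f: "f \<in> ?X" and T: "T \<in> Pow R" by auto
    have "{i \<in> {..<m}. block n i S \<in> F} = {i \<in> {..<m}. f i \<in> F}"
      unfolding S using blk[OF f T] by auto
    moreover have "f j \<subseteq> all_edges n" if "j < m" for j
      using f that by (auto simp: PiE_iff)
    then have "S \<subseteq> all_edges N"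
      using T shift_edge_in[OF _ _ N] by (fastforce simp: S \<Phi>_def R_def)
    ultimately show "S \<in> ?H" using f by simp
  qed
  moreover have "finite ?H" by (simp add: finite_all_edges)
  ultimately have "card (?X \<times> Pow R) \<le> card ?H"
    by (rule card_inj_on_le)
  also have "card (?X \<times> Pow R) =
      (m choose k) * card F ^ k * (2 ^ (n choose 2) - card F) ^ (m - k) * 2 ^ card R"
    using card_PiE_exactly[OF _ F, of m k]
    by (simp add: card_cartesian_product card_Pow finR finite_all_edges card_all_edges)
  finally show ?thesis
    by (simp add: card_N power_add)
qed

text \<open>Two sets of \<open>k\<close> blocks out of \<open>m\<close> share at least
  \<open>2 * k - m\<close>, hence at least \<open>t\<close>, of them. On each shared block two
  members of \<open>F\<close> meet in a graph containing \<Gamma>.\<close>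

lemma mu_copies_ge:
  assumes \<Gamma>: "simple_graph \<Gamma>" and F: "F \<subseteq> Pow (all_edges n)"
    and int: "\<And>S S'. S \<in> F \<Longrightarrow> S' \<in> F \<Longrightarrow> contains \<Gamma> ({1..n}, S \<inter> S')"
    and N: "m * n \<le> N" and t: "m + t \<le> 2 * k"
  shows "real ((m choose k) * card F ^ k * (2 ^ (n choose 2) - card F) ^ (m - k))
    / 2 ^ (m * (n choose 2)) \<le> mu (contains (copies t \<Gamma>)) N"
proof -
  let ?I = "\<lambda>S. {i \<in> {..<m}. block n i S \<in> F}"
  let ?H = "{S \<in> Pow (all_edges N). card (?I S) = k}"
  let ?L = "(m choose k) * card F ^ k * (2 ^ (n choose 2) - card F) ^ (m - k)"
  have cross: "x / u \<le> y / v" if "x * v \<le> y * u" "0 < u" "0 < v" for x y u v :: real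
    using that by (simp add: field_simps)
  have "real (?L * 2 ^ (N choose 2)) \<le> real (card ?H * 2 ^ (m * (n choose 2)))"
    unfolding of_nat_le_iff by (rule card_exactly_k_blocks[OF F N])
  then have "real ?L * 2 ^ (N choose 2) \<le> real (card ?H) * 2 ^ (m * (n choose 2))"
    by (simp only: of_nat_mult of_nat_power of_nat_numeral)
  then have "real ?L / 2 ^ (m * (n choose 2)) \<le> real (card ?H) / 2 ^ (N choose 2)"
    by (intro cross) simp_all
  also have "\<dots> \<le> mu (contains (copies t \<Gamma>)) N"
  proof (rule mu_ge)
    fix S S' assume S: "S \<in> ?H" "S' \<in> ?H"
    have "card (?I S \<union> ?I S') \<le> card {..<m}"
      by (rule card_mono) auto
    moreover have "card (?I S) + card (?I S') = card (?I S \<union> ?I S') + card (?I S \<inter> ?I S')"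
      by (rule card_Un_Int) auto
    ultimately have "t \<le> card (?I S \<inter> ?I S')"
      using S t by simp
    then show "contains (copies t \<Gamma>) ({1..N}, S \<inter> S')"
      by (rule contains_copies_of_blocks[OF \<Gamma> N, rotated]) (auto simp: block_Int simp del: One_nat_def intro: int)
  qed auto
  finally show ?thesis .
qed

section \<open>Monotonicity and existence of the limit\<close>

text \<open>An optimal family on \<open>n\<close> vertices, placed on a single block
  (\<open>m = k = t = 1\<close>), yields a family of at least the same density on \<open>N\<close>
  vertices.\<close>

lemma incseq_mu_contains:
  assumes "simple_graph \<Gamma>"
  shows "incseq (mu (contains \<Gamma>))"
proof (rule monoI)
  fix n N :: nat assume N: "n \<le> N"
  obtain F where F: "F \<subseteq> Pow (all_edges n)"
      "\<And>S S'. S \<in> F \<Longrightarrow> S' \<in> F \<Longrightarrow> contains \<Gamma> ({1..n}, S \<inter> S')"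
    and mu: "mu (contains \<Gamma>) n = real (card F) / 2 ^ (n choose 2)"
    using mu_attained[of n "contains \<Gamma>"] by blast
  have "contains (copies 1 \<Gamma>) = (contains \<Gamma> :: nat graph \<Rightarrow> bool)"
    using contains_copies_1[OF assms] by blast
  then show "mu (contains \<Gamma>) n \<le> mu (contains \<Gamma>) N"
    using mu_copies_ge[OF assms F, of 1 N 1 1] N by (simp add: mu)
qed

lemma mu_contains_tendsto:
  assumes "simple_graph \<Gamma>" "edges \<Gamma> \<noteq> {}"
  obtains p where "mu (contains \<Gamma>) \<longlonglongrightarrow> p" "\<And>n. mu (contains \<Gamma>) n \<le> p"
  using incseq_convergent[OF incseq_mu_contains[OF assms(1)]] mu_contains_le_half[OF assms] by metis

section \<open>Largest binomial term and the resulting lower bound for disjoint copies\<close>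

text \<open>The terms are unnormalised binomial probabilities with success probability
  \<open>a / (a + c)\<close>. The number of trials is a multiple of \<open>a + c\<close>, so the
  mean \<open>a * s\<close> is an integer; the terms do not decrease before it and do not increase
  after it.\<close>

lemma binomial_mode:
  fixes a c s j :: nat
  assumes "0 < c" "j \<le> (a + c) * s"
  shows "((a + c) * s choose j) * a ^ j * c ^ ((a + c) * s - j)
    \<le> ((a + c) * s choose (a * s)) * a ^ (a * s) * c ^ (c * s)"
proof -
  define m where "m = (a + c) * s"
  define f where "f = (\<lambda>j. (m choose j) * a ^ j * c ^ (m - j))"
  have m: "m = a * s + c * s" by (simp add: m_def algebra_simps)
  \<comment> \<open>The quotient of consecutive terms with denominators cleared; comparing
    \<open>Suc j * c\<close> with \<open>(m - j) * a\<close> decides the direction of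
    growth.\<close>
  have ratio: "Suc j * c * f (Suc j) = (m - j) * a * f j" if "j < m" for j
  proof -
    have "Suc j * (m choose Suc j) = (m - j) * (m choose j)"
      using binomial_absorb_comp[of m j] binomial_absorption[of j m] by simp
    moreover have "c ^ (m - j) = c * c ^ (m - Suc j)"
      using that by (metis Suc_diff_Suc power_Suc)
    ultimately show ?thesis
      unfolding f_def by (metis (no_types, lifting) mult.assoc mult.left_commute power_Suc)
  qed
  have up: "f j \<le> f (Suc j)" if "j < a * s" for j
  proof -
    have "Suc j * c \<le> (a * s) * c" using that by (intro mult_le_mono1) simp
    also have "\<dots> = (c * s) * a" by simp
    also have "\<dots> \<le> (m - j) * a" using that by (intro mult_le_mono1) (simp add: m)
    finally have "Suc j * c * f j \<le> (m - j) * a * f j" by (rule mult_le_mono1)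
    also have "\<dots> = Suc j * c * f (Suc j)" using ratio[of j] that by (simp add: m)
    finally show ?thesis using assms(1) by (simp del: mult_Suc)
  qed
  have down: "f (Suc j) \<le> f j" if "a * s \<le> j" "j < m" for j
  proof -
    have "(m - j) * a \<le> (c * s) * a" using that by (intro mult_le_mono1) (simp add: m)
    also have "\<dots> = (a * s) * c" by simp
    also have "\<dots> \<le> Suc j * c" using that by (intro mult_le_mono1) simp
    finally have "(m - j) * a * f j \<le> Suc j * c * f j" by (rule mult_le_mono1)
    then have "Suc j * c * f (Suc j) \<le> Suc j * c * f j" using ratio[OF that(2)] by simp
    then show ?thesis using assms(1) by (simp del: mult_Suc)
  qed
  have "f j \<le> f (a * s)"
  proof (cases "j \<le> a * s")
    case True
    then show ?thesis
    proof (induction rule: inc_induct)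
      case (step i)
      then show ?case using up[of i] by simp
    qed simp
  next
    case False
    then have "a * s \<le> j" by simp
    then show ?thesis using assms(2)[folded m_def]
    proof (induction rule: dec_induct)
      case (step i)
      then show ?case using down[of i] by simp
    qed simp
  qed
  then show ?thesis by (simp add: f_def m_def[symmetric]) (simp add: m)
qed

text \<open>The terms of the expansion of \<open>(a + c) ^ m\<close>, with
  \<open>m = (a + c) * s\<close>, number \<open>m + 1\<close>, so the largest is at least their
  average.\<close>

lemma binomial_central_term_ge:
  fixes a c s :: nat
  assumes "0 < c"
  shows "(a + c) ^ ((a + c) * s)
    \<le> ((a + c) * s + 1) * (((a + c) * s choose (a * s)) * a ^ (a * s) * c ^ (c * s))"
proof -
  let ?m = "(a + c) * s"
  let ?M = "(?m choose (a * s)) * a ^ (a * s) * c ^ (c * s)"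
  have "(a + c) ^ ?m = (\<Sum>j\<le>?m. (?m choose j) * a ^ j * c ^ (?m - j))"
    using binomial[of a c ?m] by simp
  also have "\<dots> \<le> (\<Sum>j\<le>?m. ?M)"
    by (rule sum_mono) (use binomial_mode[OF assms] in simp)
  also have "\<dots> = (?m + 1) * ?M" by simp
  finally show ?thesis .
qed

text \<open>The choice \<open>m = (a + c) s\<close>, \<open>k = c s\<close> gives \<open>2k - m = (c - a) s\<close>; swapping the exponents of
  \<open>a\<close> and \<open>c\<close> turns the resulting binomial probability into the largest one, at the cost of the
  factor \<open>(a / c) ^ ((c - a) s)\<close>.\<close>

lemma mu_copies_ge_ratio_power:
  assumes \<Gamma>: "simple_graph \<Gamma>" and F: "F \<subseteq> Pow (all_edges n)"
    and int: "\<And>S S'. S \<in> F \<Longrightarrow> S' \<in> F \<Longrightarrow> contains \<Gamma> ({1..n}, S \<inter> S')"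
    and a: "a = card F" "0 < a" and c: "a + c = 2 ^ (n choose 2)" "a < c"
    and N: "(a + c) * (t + 1) * n \<le> N"
  shows "(real a / real c) ^ (t + (c - a)) / (real ((a + c) * (t + 1)) + 1)
    \<le> mu (contains (copies t \<Gamma>)) N"
proof -
  define d where "d = c - a"
  \<comment> \<open>With this \<open>s\<close>, \<open>d * s\<close> is the first multiple of
    \<open>d\<close> above \<open>t\<close>: it supplies \<open>t\<close> common blocks and
    overshoots by at most \<open>d\<close>.\<close>
  define s where "s = t div d + 1"
  define m where "m = (a + c) * s"
  have d: "0 < d" "c = a + d" using c(2) by (auto simp: d_def)
  have "t div d \<le> t" by simp
  then have s_le: "s \<le> t + 1" by (simp add: s_def)
  have ds: "t \<le> d * s" "d * s \<le> t + d"
  proof -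
    have "d * s = d * (t div d) + d" by (simp add: s_def)
    moreover have "t = d * (t div d) + t mod d" "t mod d < d" using d(1) by auto
    ultimately show "t \<le> d * s" "d * s \<le> t + d" by linarith+
  qed
  have m: "m = a * s + c * s" by (simp add: m_def algebra_simps)
  have "m \<le> (a + c) * (t + 1)" unfolding m_def using s_le by (rule mult_le_mono2)
  then have "m * n \<le> (a + c) * (t + 1) * n" by (rule mult_le_mono1)
  then have mN: "m * n \<le> N" using N by (rule le_trans)
  have "m + t \<le> 2 * (c * s)" using ds(1) by (simp add: m d(2) algebra_simps)
  note ge = mu_copies_ge[OF \<Gamma> F int mN this]
  define r where "r = real a / real c"
  have r: "0 < r" "r \<le> 1" using a c by (auto simp: r_def)
  let ?M = "(m choose (a * s)) * a ^ (a * s) * c ^ (c * s)"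
  \<comment> \<open>As \<open>r \<le> 1\<close>, raising the exponent to \<open>t + d\<close> and
    enlarging \<open>m\<close> to \<open>(a + c) * (t + 1)\<close> only lowers the value; the bound
    becomes free of \<open>s\<close>.\<close>
  have "r ^ (t + d) / (real ((a + c) * (t + 1)) + 1) \<le> r ^ (d * s) / (real m + 1)"
    using r ds(2) \<open>m \<le> (a + c) * (t + 1)\<close>
    by (intro frac_le power_decreasing) (auto simp del: of_nat_mult of_nat_add)
  also have "\<dots> \<le> r ^ (d * s) * (real ?M / real (a + c) ^ m)"
  proof -
    have "real ((a + c) ^ m) \<le> real ((m + 1) * ?M)"
      unfolding of_nat_le_iff m_def by (rule binomial_central_term_ge) (use c in simp)
    then have "real (a + c) ^ m \<le> (real m + 1) * real ?M"
      by (simp only: of_nat_mult of_nat_add of_nat_power of_nat_1)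
    moreover have "0 < real (a + c) ^ m" using c(2) by simp
    ultimately have "1 / (real m + 1) \<le> real ?M / real (a + c) ^ m"
      by (simp add: divide_simps mult.commute del: of_nat_add of_nat_mult)
    then have "r ^ (d * s) * (1 / (real m + 1)) \<le> r ^ (d * s) * (real ?M / real (a + c) ^ m)"
      using r by (intro mult_left_mono) auto
    then show ?thesis by simp
  qed
  also have "\<dots> = real ((m choose (c * s)) * a ^ (c * s) * c ^ (a * s)) / real (a + c) ^ m"
  proof -
    have "m choose (c * s) = m choose (a * s)"
      using binomial_symmetric[of "a * s" m] by (simp add: m)
    moreover have "r ^ (d * s) * (real a ^ (a * s) * real c ^ (c * s)) = real a ^ (c * s) * real c ^ (a * s)"
    proof -
      have "c * s = a * s + d * s" by (simp add: d(2) algebra_simps)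
      moreover have "real c \<noteq> 0" using c(2) by simp
      ultimately show ?thesis by (simp add: r_def power_divide power_add)
    qed
    ultimately show ?thesis by (simp add: mult.assoc mult.left_commute del: of_nat_add)
  qed
  also have "\<dots> = real ((m choose (c * s)) * card F ^ (c * s) * (2 ^ (n choose 2) - card F) ^ (m - c * s))
    / 2 ^ (m * (n choose 2))"
  proof -
    have "2 ^ (n choose 2) - card F = c" using a(1) c(1) by simp
    moreover have "m - c * s = a * s" by (simp add: m)
    moreover have "real (a + c) ^ m = 2 ^ (m * (n choose 2))"
      by (simp add: c(1) power_mult[symmetric] mult.commute del: of_nat_add)
    ultimately show ?thesis by (simp only: a(1))
  qed
  also have "\<dots> \<le> mu (contains (copies t \<Gamma>)) N" by (rule ge)
  finally show ?thesis by (simp only: r_def d_def)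
qed

section \<open>Exponential comparison and passage to the limit\<close>

text \<open>After division by \<open>r ^ t\<close> the claim is that \<open>(\<rho> / r) ^ t\<close>
  times a linear function of \<open>t\<close> tends to 0. This absorbs the polynomial loss of the
  binomial estimate.\<close>

lemma eventually_power_less_power_over_linear:
  fixes r \<rho> A C :: real
  assumes "0 \<le> \<rho>" "\<rho> < r" "0 < C" "0 \<le> A"
  shows "eventually (\<lambda>t. \<rho> ^ t < C * r ^ t / (A * (real t + 1) + 1)) sequentially"
proof -
  define x where "x = \<rho> / r"
  have r: "0 < r" using assms by linarith
  have x: "0 \<le> x" "x < 1" using assms r by (auto simp: x_def)
  have "(\<lambda>t. A * (real t * x ^ t) + (A + 1) * x ^ t) \<longlonglongrightarrow> A * 0 + (A + 1) * 0"
    using x by (intro tendsto_intros powser_times_n_limit_0 LIMSEQ_power_zero) auto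
  then have "eventually (\<lambda>t. A * (real t * x ^ t) + (A + 1) * x ^ t < C) sequentially"
    using assms(3) by (intro order_tendstoD) auto
  then show ?thesis
  proof eventually_elim
    case (elim t)
    have "0 < A * (real t + 1) + 1" using assms(4) by (simp add: add_nonneg_pos)
    moreover have "\<rho> ^ t = x ^ t * r ^ t" using r by (simp add: x_def power_divide)
    moreover have "(A * (real t * x ^ t) + (A + 1) * x ^ t) * r ^ t < C * r ^ t"
      using elim r by simp
    ultimately show ?case by (simp add: pos_less_divide_eq algebra_simps)
  qed
qed

text \<open>\<open>lim\<close> is a definite description, so convergence is asserted next to each
  limit. The range \<epsilon> < 2 gives \<open>\<bar>1 - \<epsilon>\<bar> < 1\<close>; for large
  \<epsilon> the even powers of \<open>(1 - \<epsilon>) * (p / (1 - p))\<close> would exceed 1/2, an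
  upper bound for \<open>mu\<close>.\<close>

theorem theorem3:
  fixes \<Gamma> :: "'a graph" and p :: real
  assumes "simple_graph \<Gamma>"
    and "edges \<Gamma> \<noteq> {}"
    and "p = lim (\<lambda>n. mu (contains \<Gamma>) n)"
  shows "convergent (\<lambda>n. mu (contains \<Gamma>) n) \<and>
    (\<forall>\<epsilon>::real. 0 < \<epsilon> \<and> \<epsilon> < 2 \<longrightarrow>
      (\<exists>T::nat. \<forall>t::nat. t > T \<longrightarrow>
        convergent (\<lambda>n. mu (contains (copies t \<Gamma>)) n) \<and>
        lim (\<lambda>n. mu (contains (copies t \<Gamma>)) n) > ((1 - \<epsilon>) * (p / (1 - p))) ^ t))"
proof (intro conjI allI impI)
  obtain p' where "mu (contains \<Gamma>) \<longlonglongrightarrow> p'" and le_p': "\<And>n. mu (contains \<Gamma>) n \<le> p'"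
    using mu_contains_tendsto[OF assms(1,2)] by metis
  moreover have "p = p'" using calculation(1) by (simp add: assms(3) limI)
  ultimately have lim: "mu (contains \<Gamma>) \<longlonglongrightarrow> p" and le_p: "\<And>n. mu (contains \<Gamma>) n \<le> p"
    by simp_all
  show "convergent (mu (contains \<Gamma>))" using lim by (rule convergentI)
  have p_pos: "0 < p" using mu_contains_pos[OF assms(1)] le_p by (rule less_le_trans)
  have p_le: "p \<le> 1 / 2"
    using lim mu_contains_le_half[OF assms(1,2)] by (intro LIMSEQ_le_const2) auto
  fix \<epsilon> :: real
  assume \<epsilon>: "0 < \<epsilon> \<and> \<epsilon> < 2"
  \<comment> \<open>For \<epsilon> > 1 the base in the claim is negative; the absolute value makes
    \<open>\<rho> ^ t\<close> an upper bound for every \<open>t\<close>.\<close>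
  define \<rho> where "\<rho> = \<bar>1 - \<epsilon>\<bar> * (p / (1 - p))"
  have ratio_pos: "0 < p / (1 - p)" using p_pos p_le by simp
  have "\<bar>1 - \<epsilon>\<bar> < 1" using \<epsilon> by (simp add: abs_if)
  then have "\<rho> < 1 * (p / (1 - p))"
    unfolding \<rho>_def using ratio_pos by (rule mult_strict_right_mono)
  then have \<rho>: "0 \<le> \<rho>" "\<rho> < p / (1 - p)"
    using ratio_pos by (simp_all only: \<rho>_def mult_nonneg_nonneg abs_ge_zero less_imp_le mult_1)
  \<comment> \<open>The density left after removing one graph from an optimal family; the loss
    vanishes as \<open>n\<close> grows, so the limit is still \<open>p\<close>.\<close>
  define q where "q = (\<lambda>n. mu (contains \<Gamma>) n - (1 / 2) ^ (n choose 2))"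
  have "filterlim (\<lambda>n. n choose 2) sequentially sequentially"
  proof (rule filterlim_at_top_mono[OF filterlim_minus_const_nat_at_top[of 1]])
    show "\<forall>\<^sub>F n in sequentially. n - 1 \<le> n choose 2"
    proof (intro always_eventually allI)
      fix n :: nat
      show "n - 1 \<le> n choose 2" by (cases n) (simp_all add: numeral_2_eq_2)
    qed
  qed
  then have "(\<lambda>n. (1 / 2 :: real) ^ (n choose 2)) \<longlonglongrightarrow> 0"
    by (rule filterlim_compose[rotated]) (simp add: LIMSEQ_power_zero)
  then have q: "q \<longlonglongrightarrow> p"
    unfolding q_def using tendsto_diff[OF lim] by fastforce
  then have "(\<lambda>n. q n / (1 - q n)) \<longlonglongrightarrow> p / (1 - p)"
    using p_le by (intro tendsto_intros) auto
  then have "eventually (\<lambda>n. \<rho> < q n / (1 - q n)) sequentially"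
    using \<rho>(2) by (rule order_tendstoD)
  moreover have "eventually (\<lambda>n. 0 < q n) sequentially"
    using q p_pos by (rule order_tendstoD)
  ultimately have "eventually (\<lambda>n. \<rho> < q n / (1 - q n) \<and> 0 < q n) sequentially"
    by eventually_elim simp
  \<comment> \<open>\<open>n\<close> is fixed independently of \<open>t\<close>, so \<open>a\<close>
    and \<open>c\<close> below are constants while \<open>t\<close> grows.\<close>
  then obtain n where n: "\<rho> < q n / (1 - q n)" "0 < q n"
    using eventually_happens'[OF sequentially_bot] by blast
  obtain F0 where F0: "F0 \<subseteq> Pow (all_edges n)"
      "\<And>S S'. S \<in> F0 \<Longrightarrow> S' \<in> F0 \<Longrightarrow> contains \<Gamma> ({1..n}, S \<inter> S')"
    and mu: "mu (contains \<Gamma>) n = real (card F0) / 2 ^ (n choose 2)"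
    using mu_attained[of n "contains \<Gamma>"] by blast
  have qn: "q n = (real (card F0) - 1) / 2 ^ (n choose 2)"
    by (simp add: q_def mu power_divide diff_divide_distrib)
  \<comment> \<open>Positivity of \<open>q n\<close> means that at least two graphs are present, so
    one can be removed without emptying the family.\<close>
  then have F0_card: "1 < card F0" using n(2) by (simp add: zero_less_divide_iff)
  then obtain S0 where S0: "S0 \<in> F0" by fastforce
  \<comment> \<open>Removing one graph makes the density strictly less than \<open>1/2\<close>, even if \<open>p = 1/2\<close> is attained.\<close>
  define F where "F = F0 - {S0}"
  define a where "a = card F"
  define c where "c = 2 ^ (n choose 2) - a"
  have F: "F \<subseteq> Pow (all_edges n)"
      "\<And>S S'. S \<in> F \<Longrightarrow> S' \<in> F \<Longrightarrow> contains \<Gamma> ({1..n}, S \<inter> S')"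
    using F0 by (auto simp: F_def)
  have a_eq: "a = card F0 - 1" using S0 by (simp add: a_def F_def)
  have "2 * card F0 \<le> 2 ^ (n choose 2)"
    using card_intersecting_le[OF assms(1,2) F0] .
  then have ac: "0 < a" "a + c = 2 ^ (n choose 2)" "a < c"
    using F0_card by (auto simp: a_eq c_def)
  have two: "2 ^ (n choose 2) = real a + real c"
    using ac(2) by (metis of_nat_add of_nat_numeral of_nat_power)
  have q_eq: "q n = real a / (real a + real c)"
    using F0_card by (simp add: qn two a_eq of_nat_diff)
  moreover have "1 - q n = real c / (real a + real c)"
    using ac(3) by (simp add: q_eq diff_eq_eq add_divide_distrib[symmetric])
  ultimately have "q n / (1 - q n) = real a / real c"
    using ac by simp
  then have r: "\<rho> < real a / real c" using n(1) by simp
  \<comment> \<open>The constant \<open>(a / c) ^ (c - a)\<close> pays for the overshoot in the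
    exponent, the linear denominator for averaging over the binomial terms.\<close>
  have "eventually (\<lambda>t. \<rho> ^ t < (real a / real c) ^ (c - a) * (real a / real c) ^ t
      / (real (a + c) * (real t + 1) + 1)) sequentially"
    using ac by (intro eventually_power_less_power_over_linear[OF \<rho>(1) r]) auto
  then obtain T where T: "\<And>t. T \<le> t \<Longrightarrow> \<rho> ^ t < (real a / real c) ^ (c - a) * (real a / real c) ^ t
      / (real (a + c) * (real t + 1) + 1)"
    by (auto simp: eventually_sequentially)
  show "\<exists>T::nat. \<forall>t::nat. t > T \<longrightarrow>
        convergent (\<lambda>n. mu (contains (copies t \<Gamma>)) n) \<and>
        lim (\<lambda>n. mu (contains (copies t \<Gamma>)) n) > ((1 - \<epsilon>) * (p / (1 - p))) ^ t"
  proof (intro exI allI impI)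
    fix t assume t: "T < t"
    \<comment> \<open>\<open>t > T\<close> forces \<open>t > 0\<close>, so the disjoint copies have
      an edge and the limit exists.\<close>
    obtain l where l: "mu (contains (copies t \<Gamma>)) \<longlonglongrightarrow> l"
      using mu_contains_tendsto[OF simple_graph_copies[OF assms(1)] edges_copies_nonempty[OF assms(2)], of t]
        t by (metis gr_zeroI not_less_zero)
    have "((1 - \<epsilon>) * (p / (1 - p))) ^ t \<le> \<bar>((1 - \<epsilon>) * (p / (1 - p))) ^ t\<bar>" by simp
    also have "\<dots> = \<rho> ^ t"
      using p_pos p_le by (simp add: \<rho>_def power_abs abs_mult)
    also have "\<dots> < (real a / real c) ^ (t + (c - a)) / (real ((a + c) * (t + 1)) + 1)"
      using T[of t] t by (simp add: power_add algebra_simps)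
    \<comment> \<open>The bound does not depend on \<open>N\<close> and holds for all
      \<open>N \<ge> (a + c) * (t + 1) * n\<close>, so it passes to the limit.\<close>
    also have "\<dots> \<le> l"
      using mu_copies_ge_ratio_power[OF assms(1) F a_def ac, of t]
      by (intro LIMSEQ_le_const[OF l]) blast
    finally show "convergent (mu (contains (copies t \<Gamma>))) \<and>
        lim (mu (contains (copies t \<Gamma>))) > ((1 - \<epsilon>) * (p / (1 - p))) ^ t"
      using l by (auto simp: limI convergentI)
  qed
qed

end
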